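(* Let $f$ be a non-linear tropical entire function, let $\alpha>0$ and $c\in\mathbb{R}$. Then the function $$f(x)^{\otimes\alpha}\otimes f(x+c)=\alpha f(x)+f(x+c)$$ has at least one root.
   Context: A tropical meromorphic function is a continuous piecewise linear function $f:\mathbb{R}\to\mathbb{R}$ (arbitrary real slopes, points of slope change having no accumulation point in $\mathbb{R}$). For $x_0\in\mathbb{R}$ put $\omega_f(x_0)=\lim_{\varepsilon\to0^+}[f'(x_0+\varepsilon)-f'(x_0-\varepsilon)]$; $x_0$ is a root of $f$ if $\omega_f(x_0)>0$, and a pole if $\omega_f(x_0)<0$. A tropical entire function is a tropical meromorphic function without poles. Linear functions are those of the form $x\mapsto px+q$ with $p,q\in\mathbb{R}$. Max-plus notation: $x\otimes y=x+y$, $x^{\otimes\alpha}=\alpha x$. *)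

theory Defs
  imports "HOL-Analysis.Analysis"
begin

text \<open>
  The set \<open>S\<close> contains all points of slope change. It has no accumulation point, so every bounded
  interval meets it in a finite set; the slopes are arbitrary reals.
\<close>
definition tropical_meromorphic :: "(real \<Rightarrow> real) \<Rightarrow> bool" where
  "tropical_meromorphic f \<longleftrightarrow>
     continuous_on UNIV f \<and>
     (\<exists>S. (\<forall>x. \<not> x islimpt S) \<and>
          (\<forall>a b. a < b \<and> {a<..<b} \<inter> S = {} \<longrightarrow> (\<exists>p q. \<forall>x\<in>{a<..<b}. f x = p * x + q)))"

text \<open>
  The limit is only meaningful if it exists, which is the case at every point of a tropical
  meromorphic function: both arguments of \<open>deriv\<close> avoid the points of slope change for all
  sufficiently small \<open>\<epsilon> > 0\<close>.
\<close>
definition tropical_omega :: "(real \<Rightarrow> real) \<Rightarrow> real \<Rightarrow> real" where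
  "tropical_omega f x\<^sub>0 = Lim (at_right 0) (\<lambda>\<epsilon>. deriv f (x\<^sub>0 + \<epsilon>) - deriv f (x\<^sub>0 - \<epsilon>))"

definition tropical_root :: "(real \<Rightarrow> real) \<Rightarrow> real \<Rightarrow> bool" where
  "tropical_root f x\<^sub>0 \<longleftrightarrow> tropical_omega f x\<^sub>0 > 0"

definition tropical_pole :: "(real \<Rightarrow> real) \<Rightarrow> real \<Rightarrow> bool" where
  "tropical_pole f x\<^sub>0 \<longleftrightarrow> tropical_omega f x\<^sub>0 < 0"

definition tropical_entire :: "(real \<Rightarrow> real) \<Rightarrow> bool" where
  "tropical_entire f \<longleftrightarrow> tropical_meromorphic f \<and> (\<forall>x\<^sub>0. \<not> tropical_pole f x\<^sub>0)"

text \<open>Linear in the sense of affine, unlike the library's \<open>linear\<close>.\<close>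
definition linear_function :: "(real \<Rightarrow> real) \<Rightarrow> bool" where
  "linear_function f \<longleftrightarrow> (\<exists>p q. \<forall>x. f x = p * x + q)"

definition tropical_mult :: "real \<Rightarrow> real \<Rightarrow> real" (infixl "\<otimes>\<^sub>t" 70) where
  "x \<otimes>\<^sub>t y = x + y"

definition tropical_power :: "real \<Rightarrow> real \<Rightarrow> real" (infixr "^\<^sub>t" 80) where
  "x ^\<^sub>t \<alpha> = \<alpha> * x"

end

theory Submission imports Defs begin

text \<open>
  The slope jump of \<open>\<alpha> f(x) + f(x + c)\<close> at \<open>x\<close> is \<open>\<alpha> \<omega>\<^sub>f(x) + \<omega>\<^sub>f(x + c)\<close>. Both terms are nonnegative
  since \<open>f\<close> has no poles, and the first is positive somewhere, as a function without slope jumps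
  is affine.
\<close>

text \<open>The one-sided slopes \<open>l\<close> and \<open>r\<close> are recorded by exact
  equations near \<open>x\<close> rather than as one-sided derivatives. The equations add up under
  sums and shifts, and they determine the derivative on both sides of \<open>x\<close>.\<close>

definition germ_slopes :: "(real \<Rightarrow> real) \<Rightarrow> real \<Rightarrow> real \<Rightarrow> real \<Rightarrow> bool" where
  "germ_slopes f x l r \<longleftrightarrow>
     (\<forall>\<^sub>F h in at_right 0. f (x + h) = f x + r * h \<and> f (x - h) = f x - l * h)"

text \<open>Both formulas are trivial at \<open>y = x\<close>, so the intervals may include
  \<open>x\<close>. When the two slopes agree, the formulas therefore glue to one on a full
  neighbourhood.\<close>

lemma germ_slopesE:
  assumes "germ_slopes f x l r"
  obtains d where "d > 0"
    "\<And>y. x \<le> y \<Longrightarrow> y < x + d \<Longrightarrow> f y = f x + r * (y - x)"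
    "\<And>y. x - d < y \<Longrightarrow> y \<le> x \<Longrightarrow> f y = f x + l * (y - x)"
proof -
  obtain d where d: "d > 0"
      "\<And>h. 0 < h \<Longrightarrow> h < d \<Longrightarrow> f (x + h) = f x + r * h \<and> f (x - h) = f x - l * h"
    using assms by (auto simp: germ_slopes_def eventually_at_right_field)
  show thesis
  proof
    show "d > 0" by fact
    show "f y = f x + r * (y - x)" if "x \<le> y" "y < x + d" for y
      using d(2)[of "y - x"] that by (cases "y = x") auto
    show "f y = f x + l * (y - x)" if "x - d < y" "y \<le> x" for y
      using d(2)[of "x - y"] that by (cases "y = x") (auto simp: algebra_simps)
  qed
qed

lemma has_real_derivative_affine_on_open:
  fixes f :: "real \<Rightarrow> real"
  assumes "open U" "y \<in> U" "\<And>z. z \<in> U \<Longrightarrow> f z = a + r * (z - x)"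
  shows "(f has_real_derivative r) (at y)"
proof (rule has_field_derivative_transform_within_open[OF _ assms(1,2)])
  show "((\<lambda>z. a + r * (z - x)) has_real_derivative r) (at y)"
    by (auto intro!: derivative_eq_intros)
qed (use assms(3) in auto)

text \<open>For small \<open>h > 0\<close> the points \<open>x + h\<close> and \<open>x - h\<close>
  lie in open intervals on which \<open>f\<close> is affine, so the expression under the limit is
  eventually constant. The derivative at \<open>x\<close> itself, which may fail to exist, never
  enters.\<close>

lemma tropical_omega_germ_slopes:
  assumes "germ_slopes f x l r"
  shows "tropical_omega f x = r - l"
proof -
  obtain d where d: "d > 0"
    "\<And>y. x \<le> y \<Longrightarrow> y < x + d \<Longrightarrow> f y = f x + r * (y - x)"
    "\<And>y. x - d < y \<Longrightarrow> y \<le> x \<Longrightarrow> f y = f x + l * (y - x)"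
    using germ_slopesE[OF assms] by blast
  have "deriv f (x + h) - deriv f (x - h) = r - l" if "0 < h" "h < d" for h
  proof -
    have "(f has_real_derivative r) (at (x + h))"
      by (rule has_real_derivative_affine_on_open[where U = "{x<..<x+d}" and a = "f x" and x = x])
        (use that in \<open>auto intro: d(2)\<close>)
    moreover have "(f has_real_derivative l) (at (x - h))"
      by (rule has_real_derivative_affine_on_open[where U = "{x-d<..<x}" and a = "f x" and x = x])
        (use that in \<open>auto intro: d(3)\<close>)
    ultimately show ?thesis by (simp add: DERIV_imp_deriv)
  qed
  then have "\<forall>\<^sub>F h in at_right 0. deriv f (x + h) - deriv f (x - h) = r - l"
    using d(1) by (auto simp: eventually_at_right_field)
  then show ?thesis
    unfolding tropical_omega_def by (intro tendsto_Lim tendsto_eventually) auto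
qed

text \<open>Uniqueness of limits along \<open>A\<close>. This carries an affine formula from an open
  interval to its endpoint.\<close>

lemma affine_at_limit_point:
  fixes f :: "real \<Rightarrow> real"
  assumes "isCont f x" "x islimpt A" "\<And>y. y \<in> A \<Longrightarrow> f y = p * y + q"
  shows "f x = p * x + q"
proof (rule tendsto_unique)
  show "at x within A \<noteq> bot"
    using assms(2) by (simp add: trivial_limit_within)
  show "(f \<longlongrightarrow> f x) (at x within A)"
    using continuous_at_imp_continuous_at_within[OF assms(1)] by (simp only: continuous_within)
  have "((\<lambda>y. p * y + q) \<longlongrightarrow> p * x + q) (at x within A)"
    by (intro tendsto_intros)
  then show "(f \<longlongrightarrow> p * x + q) (at x within A)"
    by (rule Lim_transform_eventually) (simp add: eventually_at_filter assms(3))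
qed

lemma tropical_meromorphic_germ_slopes:
  assumes "tropical_meromorphic f"
  obtains l r where "germ_slopes f x l r"
proof -
  obtain S where S: "\<not> x islimpt S"
      "\<And>a b. a < b \<Longrightarrow> {a<..<b} \<inter> S = {} \<Longrightarrow> \<exists>p q. \<forall>x\<in>{a<..<b}. f x = p * x + q"
    using assms unfolding tropical_meromorphic_def by metis
  have cont: "isCont f x"
    using assms by (simp add: tropical_meromorphic_def continuous_on_eq_continuous_at)
  \<comment> \<open>Only a punctured neighbourhood of \<open>x\<close> avoids \<open>S\<close>, as
    \<open>x\<close> may belong to \<open>S\<close>; hence one affine formula per side, joined at
    \<open>x\<close> by continuity.\<close>
  obtain d where d: "d > 0" "\<And>y. y \<in> S \<Longrightarrow> y \<noteq> x \<Longrightarrow> \<not> \<bar>y - x\<bar> < d"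
    using S(1) by (auto simp: islimpt_approachable dist_real_def)
  have "{x<..<x+d} \<inter> S = {}" "{x-d<..<x} \<inter> S = {}"
    using d(2) by force+
  then obtain r q l q'
    where r: "\<And>y. y \<in> {x<..<x+d} \<Longrightarrow> f y = r * y + q"
      and l: "\<And>y. y \<in> {x-d<..<x} \<Longrightarrow> f y = l * y + q'"
    using S(2)[of x "x+d"] S(2)[of "x-d" x] d(1) by auto
  have "f x = r * x + q"
    by (rule affine_at_limit_point[where A = "{x<..<x+d}", OF cont _ r])
      (use d(1) in \<open>simp_all add: islimpt_greaterThanLessThan1\<close>)
  moreover have "f x = l * x + q'"
    by (rule affine_at_limit_point[where A = "{x-d<..<x}", OF cont _ l])
      (use d(1) in \<open>simp_all add: islimpt_greaterThanLessThan2\<close>)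
  ultimately have "germ_slopes f x l r"
    unfolding germ_slopes_def eventually_at_right_field
    by (intro exI[of _ d]) (auto simp: d(1) r l algebra_simps)
  then show thesis by (rule that)
qed

lemma germ_slopes_scale_add_shift:
  assumes "germ_slopes f x l r" "germ_slopes f (x + c) l' r'"
  shows "germ_slopes (\<lambda>x. \<alpha> * f x + f (x + c)) x (\<alpha> * l + l') (\<alpha> * r + r')"
  using assms unfolding germ_slopes_def
proof eventually_elim
  case (elim h)
  \<comment> \<open>These identities bring the arguments of the shifted summand into the form used
    by the second hypothesis.\<close>
  have "x + h + c = x + c + h" "x - h + c = x + c - h"
    by simp_all
  with elim show ?case
    by (simp only:) (simp add: algebra_simps)
qed

text \<open>The hypothesis makes the derivative locally constant, so \<open>s\<close> itself has derivative 0 everywhere.\<close>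
lemma germ_slopes_eq_imp_linear_function:
  assumes "\<And>x. germ_slopes f x (s x) (s x)"
  shows "linear_function f"
proof -
  have near: "\<exists>d>0. \<forall>y\<in>{x-d<..<x+d}. (f has_real_derivative s x) (at y)" for x
  proof -
    obtain d where d: "d > 0"
      "\<And>y. x \<le> y \<Longrightarrow> y < x + d \<Longrightarrow> f y = f x + s x * (y - x)"
      "\<And>y. x - d < y \<Longrightarrow> y \<le> x \<Longrightarrow> f y = f x + s x * (y - x)"
      using germ_slopesE[OF assms[of x]] by blast
    have "(f has_real_derivative s x) (at y)" if "y \<in> {x-d<..<x+d}" for y
    proof (rule has_real_derivative_affine_on_open[OF _ that])
      show "f z = f x + s x * (z - x)" if "z \<in> {x-d<..<x+d}" for z
        using d(2,3)[of z] that by (cases "x \<le> z") auto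
    qed simp
    then show ?thesis using d(1) by blast
  qed
  have f': "(f has_real_derivative s x) (at x)" for x
    using near[of x] by auto
  have "(s has_real_derivative 0) (at x)" for x
  proof -
    obtain d where d: "d > 0" "\<forall>y\<in>{x-d<..<x+d}. (f has_real_derivative s x) (at y)"
      using near by blast
    show ?thesis
    proof (rule has_field_derivative_transform_within_open)
      show "((\<lambda>_. s x) has_real_derivative 0) (at x)" by simp
      \<comment> \<open>At \<open>y\<close> both \<open>s y\<close> and \<open>s x\<close> are
        derivatives of \<open>f\<close>.\<close>
      show "s x = s y" if "y \<in> {x-d<..<x+d}" for y
        using DERIV_unique[OF f'[of y]] d(2) that by force
    qed (use d(1) in auto)
  qed
  then have s: "s x = s 0" for x
    by (intro DERIV_isconst_all) auto
  have "((\<lambda>x. f x - s 0 * x) has_real_derivative 0) (at x)" for x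
    using s[of x] f'[of x] by (auto intro!: derivative_eq_intros)
  then have "f x - s 0 * x = f 0 - s 0 * 0" for x
    by (intro DERIV_isconst_all[of "\<lambda>x. f x - s 0 * x"]) auto
  then have "f x = s 0 * x + f 0" for x
    by (metis diff_0_right diff_eq_eq add.commute mult_zero_right)
  then show ?thesis
    unfolding linear_function_def by blast
qed

theorem theorem7p2:
  fixes f :: "real \<Rightarrow> real" and \<alpha> c :: real
  assumes "tropical_entire f"
    and "\<not> linear_function f"
    and "\<alpha> > 0"
  shows "\<exists>x\<^sub>0. tropical_root (\<lambda>x. (f x ^\<^sub>t \<alpha>) \<otimes>\<^sub>t f (x + c)) x\<^sub>0"
proof -
  have "\<exists>l r. germ_slopes f x l r" for x
    using assms(1) tropical_meromorphic_germ_slopes unfolding tropical_entire_def by metis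
  then obtain l r where lr: "\<And>x. germ_slopes f x (l x) (r x)"
    by metis
  have le: "l x \<le> r x" for x
    using assms(1) tropical_omega_germ_slopes[OF lr[of x]]
    unfolding tropical_entire_def tropical_pole_def by (metis diff_ge_0_iff_ge not_less)
  \<comment> \<open>If the slopes agreed everywhere, \<open>f\<close> would be linear, with
    \<open>l\<close> as the slope function.\<close>
  obtain x where "l x \<noteq> r x"
    using germ_slopes_eq_imp_linear_function[of f l] lr assms(2) by metis
  then have "l x < r x"
    using le[of x] by simp
  \<comment> \<open>Strictness comes from the jump at \<open>x\<close>, scaled by \<alpha> > 0; the
    jump at \<open>x + c\<close> only has to be nonnegative.\<close>
  then have "\<alpha> * l x + l (x + c) < \<alpha> * r x + r (x + c)"
    using le[of "x + c"] assms(3) by (intro add_less_le_mono) auto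
  then have "tropical_root (\<lambda>x. \<alpha> * f x + f (x + c)) x"
    using tropical_omega_germ_slopes[OF germ_slopes_scale_add_shift[OF lr lr]]
    by (simp add: tropical_root_def)
  then show ?thesis
    by (auto simp: tropical_mult_def tropical_power_def)
qed

end
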